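(* Let $M$ be a Kähler surface. The equation $$\cos^3\alpha\, H-\big(J(J\nabla\cos\alpha)^\top\big)^\bot=0$$ for symplectic surfaces $\Sigma$ immersed in $M$ is elliptic.
   Context: $M$ is a Kähler surface (complex dimension 2) with Kähler form $\omega$, compatible complex structure $J$, and metric $\langle U,V\rangle=\omega(U,JV)$. For an oriented real surface $\Sigma$ smoothly immersed in $M$, the Kähler angle $\alpha$ is defined by $\omega|_\Sigma=\cos\alpha\, d\mu_\Sigma$. $\Sigma$ is symplectic if $\cos\alpha>0$ everywhere. $H$ is the mean curvature vector (trace of the second fundamental form), $\nabla\cos\alpha$ is the gradient of $\cos\alpha$ in the induced metric, and $(\cdot)^\top,(\cdot)^\bot$ are the components tangent and normal to $\Sigma$. Ellipticity is understood as follows: writing $\Sigma$ locally as a graph $F(x,y)=(x,y,f(x,y),g(x,y))$ of two functions $f,g$, the equation (whose left side is a normal vector field) becomes a quasilinear system of two second-order partial differential equations for $(f,g)$; the system is elliptic if its $2\times2$ principal symbol $\sigma(\xi,\eta)$ (obtained by replacing second derivatives $\partial_x^2,\partial_x\partial_y,\partial_y^2$ by $\xi^2,\xi\eta,\eta^2$) satisfies $\det\sigma(\xi,\eta)\neq0$ for all real $(\xi,\eta)\ne(0,0)$. *)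

theory Defs
  imports "HOL-Analysis.Analysis"
begin

section \<open>Smooth functions and smooth manifolds\<close>

definition dirderiv :: "'a::real_normed_vector \<Rightarrow> ('a \<Rightarrow> 'b::real_normed_vector) \<Rightarrow> 'a \<Rightarrow> 'b"
  where "dirderiv v f = (\<lambda>x. frechet_derivative f (at x) v)"

primrec Ck_on :: "nat \<Rightarrow> 'a set \<Rightarrow> ('a::real_normed_vector \<Rightarrow> 'b::real_normed_vector) \<Rightarrow> bool"
  where
    "Ck_on 0 S f \<longleftrightarrow> continuous_on S f"
  | "Ck_on (Suc k) S f \<longleftrightarrow> (\<forall>x\<in>S. f differentiable (at x)) \<and> (\<forall>v. Ck_on k S (dirderiv v f))"

text \<open>Meant for open sets \<open>S\<close>: the derivatives involved are two-sided.\<close>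

definition smooth_on :: "'a set \<Rightarrow> ('a::real_normed_vector \<Rightarrow> 'b::real_normed_vector) \<Rightarrow> bool"
  where "smooth_on S f \<longleftrightarrow> (\<forall>k. Ck_on k S f)"

text \<open>A chart is a pair \<open>(U, \<phi>)\<close>; the values of \<open>\<phi>\<close> outside \<open>U\<close> are irrelevant.\<close>

type_synonym ('a, 'n) chart = "'a set \<times> ('a \<Rightarrow> real ^ 'n)"

definition chart_image :: "('a, 'n) chart \<Rightarrow> (real ^ 'n) set"
  where "chart_image c = snd c ` fst c"

definition chart_inv :: "('a, 'n) chart \<Rightarrow> real ^ 'n \<Rightarrow> 'a"
  where "chart_inv c = inv_into (fst c) (snd c)"

definition is_chart :: "'a topology \<Rightarrow> ('a, 'n::finite) chart \<Rightarrow> bool"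
  where "is_chart M c \<longleftrightarrow> openin M (fst c) \<and> open (chart_image c) \<and>
    homeomorphic_map (subtopology M (fst c)) (top_of_set (chart_image c)) (snd c)"

definition transition :: "('a, 'n) chart \<Rightarrow> ('a, 'n) chart \<Rightarrow> real ^ 'n \<Rightarrow> real ^ 'n"
  where "transition c d = snd d \<circ> chart_inv c"

definition overlap :: "('a, 'n) chart \<Rightarrow> ('a, 'n) chart \<Rightarrow> (real ^ 'n) set"
  where "overlap c d = snd c ` (fst c \<inter> fst d)"

definition compatible_charts :: "('a, 'n::finite) chart \<Rightarrow> ('a, 'n) chart \<Rightarrow> bool"
  where "compatible_charts c d \<longleftrightarrow>
    smooth_on (overlap c d) (transition c d) \<and> smooth_on (overlap d c) (transition d c)"

definition smooth_manifold :: "'a topology \<Rightarrow> ('a, 'n::finite) chart set \<Rightarrow> bool"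
  where "smooth_manifold M \<A> \<longleftrightarrow>
    Hausdorff_space M \<and> second_countable M \<and>
    (\<forall>c\<in>\<A>. is_chart M c) \<and>
    (\<Union>c\<in>\<A>. fst c) = topspace M \<and>
    (\<forall>c\<in>\<A>. \<forall>d\<in>\<A>. compatible_charts c d) \<and>
    (\<forall>c. is_chart M c \<and> (\<forall>d\<in>\<A>. compatible_charts c d) \<longrightarrow> c \<in> \<A>)"


section \<open>Kaehler surfaces\<close>

text \<open>
  A tensor field of rank two is given by its component matrices: \<open>T c x\<close> is the matrix of the
  tensor at the point with coordinates \<open>x\<close> in the chart \<open>c\<close>, with respect to the coordinate frame.
\<close>

type_synonym ('a, 'n) tensor2 = "('a, 'n) chart \<Rightarrow> real ^ 'n \<Rightarrow> real ^ 'n ^ 'n"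

definition bilin :: "real ^ 'n ^ 'n \<Rightarrow> real ^ 'n \<Rightarrow> real ^ 'n \<Rightarrow> real"
  where "bilin A U V = U \<bullet> (A *v V)"

definition covariant_tensor :: "('a, 'n::finite) chart set \<Rightarrow> ('a, 'n) tensor2 \<Rightarrow> bool"
  where "covariant_tensor \<A> T \<longleftrightarrow>
    (\<forall>c\<in>\<A>. smooth_on (chart_image c) (T c)) \<and>
    (\<forall>c\<in>\<A>. \<forall>d\<in>\<A>. \<forall>x\<in>overlap c d.
      let D = jacobian (transition c d) (at x)
      in T c x = transpose D ** T d (transition c d x) ** D)"

definition endomorphism_tensor :: "('a, 'n::finite) chart set \<Rightarrow> ('a, 'n) tensor2 \<Rightarrow> bool"
  where "endomorphism_tensor \<A> T \<longleftrightarrow>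
    (\<forall>c\<in>\<A>. smooth_on (chart_image c) (T c)) \<and>
    (\<forall>c\<in>\<A>. \<forall>d\<in>\<A>. \<forall>x\<in>overlap c d.
      let D = jacobian (transition c d) (at x)
      in D ** T c x = T d (transition c d x) ** D)"

text \<open>
  Multiplication by \<open>\<i>\<close> on \<open>\<complex>\<^sup>2\<close> with real coordinates \<open>(Re z\<^sub>1, Im z\<^sub>1, Re z\<^sub>2, Im z\<^sub>2)\<close>.
\<close>

definition J_std :: "real ^ 4 ^ 4"
  where "J_std = vector [vector [0, -1, 0, 0],
                         vector [1,  0, 0, 0],
                         vector [0,  0, 0, -1],
                         vector [0,  0, 1, 0]]"

text \<open>
  \<open>J\<close> is a complex structure if around every point there are coordinates in which it is the
  standard one; the charts with this property form a holomorphic atlas.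
\<close>

definition complex_structure :: "'a topology \<Rightarrow> ('a, 4) chart set \<Rightarrow> ('a, 4) tensor2 \<Rightarrow> bool"
  where "complex_structure M \<A> J \<longleftrightarrow>
    endomorphism_tensor \<A> J \<and>
    (\<forall>p\<in>topspace M. \<exists>c\<in>\<A>. p \<in> fst c \<and> (\<forall>x\<in>chart_image c. J c x = J_std))"

definition closed_2form :: "('a, 'n::finite) chart set \<Rightarrow> ('a, 'n) tensor2 \<Rightarrow> bool"
  where "closed_2form \<A> \<omega> \<longleftrightarrow>
    covariant_tensor \<A> \<omega> \<and>
    (\<forall>c\<in>\<A>. \<forall>x\<in>chart_image c.
      transpose (\<omega> c x) = - \<omega> c x \<and>
      (\<forall>i j k. dirderiv (axis i 1) (\<lambda>y. \<omega> c y $ j $ k) x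
              + dirderiv (axis j 1) (\<lambda>y. \<omega> c y $ k $ i) x
              + dirderiv (axis k 1) (\<lambda>y. \<omega> c y $ i $ j) x = 0))"

definition kaehler_metric :: "real ^ 'n ^ 'n \<Rightarrow> real ^ 'n ^ 'n \<Rightarrow> real ^ 'n ^ 'n"
  where "kaehler_metric \<omega> J = \<omega> ** J"

text \<open>
  \<open>\<langle>U, V\<rangle> = \<omega>(U, JV)\<close>. Symmetry of the metric follows from the invariance of \<open>\<omega>\<close> under \<open>J\<close>.
\<close>

definition kaehler_surface ::
    "'a topology \<Rightarrow> ('a, 4) chart set \<Rightarrow> ('a, 4) tensor2 \<Rightarrow> ('a, 4) tensor2 \<Rightarrow> bool"
  where "kaehler_surface M \<A> \<omega> J \<longleftrightarrow>
    smooth_manifold M \<A> \<and> complex_structure M \<A> J \<and> closed_2form \<A> \<omega> \<and>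
    (\<forall>c\<in>\<A>. \<forall>x\<in>chart_image c.
      (\<forall>U V. bilin (\<omega> c x) (J c x *v U) (J c x *v V) = bilin (\<omega> c x) U V) \<and>
      (\<forall>U. U \<noteq> 0 \<longrightarrow> bilin (kaehler_metric (\<omega> c x) (J c x)) U U > 0))"


section \<open>Geometry of parametrized surfaces in a coordinate chart\<close>

text \<open>
  In this section \<open>\<omega>\<close>, \<open>J\<close> and \<open>G\<close> are the component matrices of the Kaehler form, the complex
  structure and the metric in a fixed chart, as functions of the coordinates, and \<open>F\<close> is a
  parametrized surface expressed in that chart. Tangent vectors of the ambient manifold are
  identified with their components.
\<close>

type_synonym field4 = "real ^ 4 \<Rightarrow> real ^ 4 ^ 4"
type_synonym surf = "real ^ 2 \<Rightarrow> real ^ 4"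

definition metric_field :: "field4 \<Rightarrow> field4 \<Rightarrow> field4"
  where "metric_field \<omega> J = (\<lambda>x. kaehler_metric (\<omega> x) (J x))"

text \<open>
  The Levi-Civita connection: \<open>christoffel G x U V\<close> is the vector with components
  \<open>\<Gamma>\<^sup>k\<^sub>i\<^sub>j(x) U\<^sup>i V\<^sup>j\<close>.
\<close>

definition christoffel :: "field4 \<Rightarrow> real ^ 4 \<Rightarrow> real ^ 4 \<Rightarrow> real ^ 4 \<Rightarrow> real ^ 4"
  where "christoffel G x U V = matrix_inv (G x) *v
    (\<chi> l. (bilin (dirderiv U G x) V (axis l 1)
           + bilin (dirderiv V G x) U (axis l 1)
           - bilin (dirderiv (axis l 1) G x) U V) / 2)"

definition tang :: "surf \<Rightarrow> 2 \<Rightarrow> surf"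
  where "tang F a = dirderiv (axis a 1) F"

definition induced_metric :: "field4 \<Rightarrow> surf \<Rightarrow> real ^ 2 \<Rightarrow> real ^ 2 ^ 2"
  where "induced_metric G F z = (\<chi> a b. bilin (G (F z)) (tang F a z) (tang F b z))"

definition induced_inv :: "field4 \<Rightarrow> surf \<Rightarrow> real ^ 2 \<Rightarrow> real ^ 2 ^ 2"
  where "induced_inv G F z = matrix_inv (induced_metric G F z)"

definition tan_part :: "field4 \<Rightarrow> surf \<Rightarrow> real ^ 2 \<Rightarrow> real ^ 4 \<Rightarrow> real ^ 4"
  where "tan_part G F z V =
    (\<Sum>a\<in>UNIV. \<Sum>b\<in>UNIV. (induced_inv G F z $ a $ b * bilin (G (F z)) V (tang F b z)) *\<^sub>R tang F a z)"

definition nor_part :: "field4 \<Rightarrow> surf \<Rightarrow> real ^ 2 \<Rightarrow> real ^ 4 \<Rightarrow> real ^ 4"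
  where "nor_part G F z V = V - tan_part G F z V"

definition second_fundamental_form :: "field4 \<Rightarrow> surf \<Rightarrow> real ^ 2 \<Rightarrow> 2 \<Rightarrow> 2 \<Rightarrow> real ^ 4"
  where "second_fundamental_form G F z a b =
    nor_part G F z (dirderiv (axis a 1) (tang F b) z
                    + christoffel G (F z) (tang F a z) (tang F b z))"

definition mean_curvature :: "field4 \<Rightarrow> surf \<Rightarrow> real ^ 2 \<Rightarrow> real ^ 4"
  where "mean_curvature G F z =
    (\<Sum>a\<in>UNIV. \<Sum>b\<in>UNIV. (induced_inv G F z $ a $ b) *\<^sub>R second_fundamental_form G F z a b)"

definition surface_gradient :: "field4 \<Rightarrow> surf \<Rightarrow> (real ^ 2 \<Rightarrow> real) \<Rightarrow> real ^ 2 \<Rightarrow> real ^ 4"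
  where "surface_gradient G F h z =
    (\<Sum>a\<in>UNIV. \<Sum>b\<in>UNIV. (induced_inv G F z $ a $ b * dirderiv (axis b 1) h z) *\<^sub>R tang F a z)"

text \<open>
  The sign \<open>s\<close> is \<open>1\<close> if the parametrization \<open>F\<close> is compatible with the orientation of the surface
  and \<open>-1\<close> otherwise, so that the oriented area element is
  \<open>s \<surd>(det I) dx \<and> dy\<close>, where \<open>I\<close> is the induced metric.
\<close>

definition cos_kaehler_angle :: "field4 \<Rightarrow> field4 \<Rightarrow> real \<Rightarrow> surf \<Rightarrow> real ^ 2 \<Rightarrow> real"
  where "cos_kaehler_angle \<omega> J s F z =
    s * bilin (\<omega> (F z)) (tang F 1 z) (tang F 2 z)
      / sqrt (det (induced_metric (metric_field \<omega> J) F z))"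

text \<open>\<open>cos\<^sup>3\<alpha> H - (J(J\<nabla>cos \<alpha>)\<^sup>\<top>)\<^sup>\<bottom>\<close>\<close>

definition surface_operator :: "field4 \<Rightarrow> field4 \<Rightarrow> real \<Rightarrow> surf \<Rightarrow> real ^ 2 \<Rightarrow> real ^ 4"
  where "surface_operator \<omega> J s F z =
    (let G = metric_field \<omega> J;
         ca = cos_kaehler_angle \<omega> J s F
     in (ca z) ^ 3 *\<^sub>R mean_curvature G F z
        - nor_part G F z (J (F z) *v tan_part G F z (J (F z) *v surface_gradient G F ca z)))"


section \<open>Graphs and ellipticity\<close>

text \<open>The two unknown functions are \<open>f = u $ 1\<close> and \<open>g = u $ 2\<close>.\<close>

definition graph :: "(real ^ 2 \<Rightarrow> real ^ 2) \<Rightarrow> surf"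
  where "graph u z = vector [z $ 1, z $ 2, u z $ 1, u z $ 2]"

text \<open>The pairs \<open>(W, u)\<close> such that the graph of \<open>u\<close> over \<open>W\<close> is a symplectic surface in a chart
  with image \<open>D\<close>.\<close>

definition symplectic_graphs ::
    "(real ^ 4) set \<Rightarrow> field4 \<Rightarrow> field4 \<Rightarrow> real \<Rightarrow> ((real ^ 2) set \<times> (real ^ 2 \<Rightarrow> real ^ 2)) set"
  where "symplectic_graphs D \<omega> J s =
    {(W, u). open W \<and> smooth_on W u \<and>
      (\<forall>z\<in>W. graph u z \<in> D \<and> cos_kaehler_angle \<omega> J s (graph u) z > 0)}"

type_synonym jet1 = "(real ^ 2) \<times> (real ^ 2) \<times> (real ^ 2 ^ 2)"

definition jet1_of :: "(real ^ 2 \<Rightarrow> real ^ 2) \<Rightarrow> real ^ 2 \<Rightarrow> jet1"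
  where "jet1_of u z = (z, u z, jacobian u (at z))"

text \<open>
  A frame of the normal bundle, given for every graph by two vectors that depend only on the
  position and the first derivatives.
\<close>

definition normal_frame ::
    "field4 \<Rightarrow> ((real ^ 2) set \<times> (real ^ 2 \<Rightarrow> real ^ 2)) set \<Rightarrow> (jet1 \<Rightarrow> 2 \<Rightarrow> real ^ 4) \<Rightarrow> bool"
  where "normal_frame G \<U> \<nu> \<longleftrightarrow>
    (\<forall>(W, u)\<in>\<U>. \<forall>z\<in>W.
      inj (\<nu> (jet1_of u z)) \<and> independent (range (\<nu> (jet1_of u z))) \<and>
      (\<forall>i a. bilin (G (graph u z)) (\<nu> (jet1_of u z) i) (tang (graph u) a z) = 0))"

definition principal_symbol :: "(2 \<Rightarrow> 2 \<Rightarrow> 2 \<Rightarrow> 2 \<Rightarrow> real) \<Rightarrow> real ^ 2 \<Rightarrow> real ^ 2 ^ 2"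
  where "principal_symbol A \<xi> = (\<chi> i j. \<Sum>a\<in>UNIV. \<Sum>b\<in>UNIV. A i j a b * \<xi> $ a * \<xi> $ b)"

text \<open>
  The components \<open>P\<^sub>i\<close> of \<open>L u = P\<^sub>1 \<nu>\<^sub>1 + P\<^sub>2 \<nu>\<^sub>2\<close> form a quasilinear second-order system
  \<open>P\<^sub>i = \<Sum>\<^sub>j\<^sub>a\<^sub>b A\<^sub>i\<^sub>j\<^sub>a\<^sub>b \<partial>\<^sub>a\<partial>\<^sub>b u\<^sub>j + B\<^sub>i\<close>, with \<open>A\<close> and \<open>B\<close> depending on the first-order jet of \<open>u\<close> only,
  and the principal symbol of this system is invertible.
  If \<open>\<U>\<close> is given by an open condition on the first-order jet, as it is for symplectic graphs, then the
  second derivatives at a point of a member of \<open>\<U>\<close> are arbitrary, and the symbol is determined by \<open>L\<close>.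
\<close>

definition elliptic_quasilinear ::
    "((real ^ 2) set \<times> (real ^ 2 \<Rightarrow> real ^ 2)) set \<Rightarrow> ((real ^ 2 \<Rightarrow> real ^ 2) \<Rightarrow> surf) \<Rightarrow>
     (jet1 \<Rightarrow> 2 \<Rightarrow> real ^ 4) \<Rightarrow> bool"
  where "elliptic_quasilinear \<U> L \<nu> \<longleftrightarrow>
    (\<exists>(A :: jet1 \<Rightarrow> 2 \<Rightarrow> 2 \<Rightarrow> 2 \<Rightarrow> 2 \<Rightarrow> real) (B :: jet1 \<Rightarrow> 2 \<Rightarrow> real).
      \<forall>(W, u)\<in>\<U>. \<forall>z\<in>W.
        let q = jet1_of u z in
        L u z = (\<Sum>i\<in>UNIV.
          ((\<Sum>j\<in>UNIV. \<Sum>a\<in>UNIV. \<Sum>b\<in>UNIV.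
              A q i j a b * dirderiv (axis a 1) (dirderiv (axis b 1) u) z $ j) + B q i) *\<^sub>R \<nu> q i)
        \<and> (\<forall>\<xi>. \<xi> \<noteq> 0 \<longrightarrow> det (principal_symbol (A q) \<xi>) \<noteq> 0))"

end

(*
  Fix a symplectic graph and a point on it, with oriented orthonormal tangent frame e1, e2, and let
  V be the symbol variation (all second derivatives d_a d_b F replaced by xi_a xi_b V). Write N for
  the normal part of V, R = xi_1 e2 - xi_2 e1 for the rotated covector, and P for the normal part of
  J R. Since omega(U, W) = <J U, W>, the differential of cos alpha has symbol -<N, P> xi, because
  P = J R + cos alpha xi, so that the tangential part of V drops out. Moreover the tangential part
  of J xi is cos alpha R. Hence the symbol of the equation is
    sigma(V) = cos^3 alpha |xi|^2 N + cos alpha <N, P> P,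
  and <sigma(V), N> = cos^3 alpha |xi|^2 |N|^2 + cos alpha <N, P>^2 > 0 unless N = 0. For a graph,
  V = (0, 0, w) is tangential only if w = 0, so sigma is injective.
*)

theory Submission
  imports Defs
begin

section \<open>Planes in a Euclidean vector space\<close>

lemma bilin_add_left: "bilin G (U + U') V = bilin G U V + bilin G U' V"
  by (simp add: bilin_def inner_left_distrib)

lemma bilin_add_right: "bilin G U (V + V') = bilin G U V + bilin G U V'"
  by (simp add: bilin_def matrix_vector_right_distrib inner_right_distrib)

lemma bilin_scaleR_left: "bilin G (r *\<^sub>R U) V = r * bilin G U V"
  by (simp add: bilin_def)

lemma bilin_scaleR_right: "bilin G U (r *\<^sub>R V) = r * bilin G U V"
  by (simp add: bilin_def matrix_vector_mult_scaleR)

lemma bilin_zero_left [simp]: "bilin G 0 V = 0"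
  by (simp add: bilin_def)

lemma bilin_zero_right [simp]: "bilin G U 0 = 0"
  by (simp add: bilin_def)

lemma bilin_zero_matrix [simp]: "bilin 0 U V = 0"
  by (simp add: bilin_def)

lemma bilin_minus_left: "bilin G (- U) V = - bilin G U V"
  by (simp add: bilin_def)

lemma bilin_minus_right: "bilin G U (- V) = - bilin G U V"
  using bilin_scaleR_right[of G U "-1" V] by simp

lemma bilin_diff_left: "bilin G (U - U') V = bilin G U V - bilin G U' V"
  by (simp add: bilin_def inner_diff_left)

lemma bilin_diff_right: "bilin G U (V - V') = bilin G U V - bilin G U V'"
  by (simp add: bilin_def matrix_vector_mult_diff_distrib inner_diff_right)

lemmas bilin_simps = bilin_add_left bilin_add_right bilin_scaleR_left bilin_scaleR_right
  bilin_minus_left bilin_minus_right bilin_diff_left bilin_diff_right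

section \<open>Gram matrices and orthogonal projection onto a plane\<close>

definition gram :: "real ^ 'n ^ 'n \<Rightarrow> (2 \<Rightarrow> real ^ 'n) \<Rightarrow> real ^ 2 ^ 2"
  where "gram G t = (\<chi> a b. bilin G (t a) (t b))"

lemma gram_nth: "gram G t $ a $ b = bilin G (t a) (t b)"
  by (simp add: gram_def)

text \<open>Coefficients of the orthogonal projection onto the span of \<open>t 1\<close> and
  \<open>t 2\<close>. The same notion serves for tangent frames and, later, for reading off
  components in the normal frame \<open>\<nu>\<close>.\<close>

definition frame_coord :: "real ^ 'n ^ 'n \<Rightarrow> (2 \<Rightarrow> real ^ 'n) \<Rightarrow> 2 \<Rightarrow> real ^ 'n \<Rightarrow> real"
  where "frame_coord G t a V = (\<Sum>b\<in>UNIV. matrix_inv (gram G t) $ a $ b * bilin G V (t b))"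

definition frame_proj :: "real ^ 'n ^ 'n \<Rightarrow> (2 \<Rightarrow> real ^ 'n) \<Rightarrow> real ^ 'n \<Rightarrow> real ^ 'n"
  where "frame_proj G t V = (\<Sum>a\<in>UNIV. frame_coord G t a V *\<^sub>R t a)"

definition frame_perp :: "real ^ 'n ^ 'n \<Rightarrow> (2 \<Rightarrow> real ^ 'n) \<Rightarrow> real ^ 'n \<Rightarrow> real ^ 'n"
  where "frame_perp G t V = V - frame_proj G t V"

lemma frame_coord_add: "frame_coord G t a (U + V) = frame_coord G t a U + frame_coord G t a V"
  by (simp add: frame_coord_def bilin_simps algebra_simps sum.distrib)

lemma frame_coord_scaleR: "frame_coord G t a (r *\<^sub>R U) = r * frame_coord G t a U"
  by (simp add: frame_coord_def bilin_simps algebra_simps sum_distrib_left)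

lemma linear_frame_coord: "linear (frame_coord G t a)"
  by (intro linearI) (simp_all add: frame_coord_add frame_coord_scaleR)

lemma linear_frame_proj: "linear (frame_proj G t)"
  by (intro linearI)
    (simp_all add: frame_proj_def frame_coord_add frame_coord_scaleR scaleR_add_left sum.distrib
      scaleR_sum_right)

lemma linear_frame_perp: "linear (frame_perp G t)"
  unfolding frame_perp_def by (intro linear_compose_sub linear_frame_proj linear_id[unfolded id_def])

lemma matrix_inv_unique:
  fixes A :: "real ^ 'n ^ 'n"
  assumes "A ** B = mat 1"
  shows "matrix_inv A = B"
proof -
  have "B ** A = mat 1"
    using assms matrix_left_right_inverse by blast
  then have "A ** matrix_inv A = mat 1 \<and> matrix_inv A ** A = mat 1"
    unfolding matrix_inv_def using assms by (rule_tac someI[of _ B]) blast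
  then show ?thesis
    by (metis \<open>B ** A = mat 1\<close> matrix_mul_assoc matrix_mul_lid matrix_mul_rid)
qed

locale metric_frame =
  fixes G :: "real ^ 'n ^ 'n" and t :: "2 \<Rightarrow> real ^ 'n"
  assumes metric_sym: "bilin G U V = bilin G V U"
    and metric_pos: "U \<noteq> 0 \<Longrightarrow> bilin G U U > 0"
    and frame_independent: "a *\<^sub>R t 1 + b *\<^sub>R t 2 = 0 \<Longrightarrow> a = 0 \<and> b = 0"
begin

abbreviation g :: "2 \<Rightarrow> 2 \<Rightarrow> real" where "g a b \<equiv> bilin G (t a) (t b)"

abbreviation detg :: real where "detg \<equiv> det (gram G t)"

lemma g_sym: "g 2 1 = g 1 2"
  by (rule metric_sym)

lemma det_gram: "detg = g 1 1 * g 2 2 - g 1 2 * g 1 2"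
  by (simp add: gram_def det_2 g_sym)

lemma det_gram_pos: "detg > 0"
proof -
  have "t 2 \<noteq> 0"
    using frame_independent[of 0 1] by auto
  then have pos: "g 2 2 > 0"
    by (rule metric_pos)
  \<comment> \<open>\<open>?v\<close> is \<open>g 2 2\<close> times the component of
    \<open>t 1\<close> orthogonal to \<open>t 2\<close>, so its squared length produces the
    determinant.\<close>
  let ?v = "g 2 2 *\<^sub>R t 1 + (- g 1 2) *\<^sub>R t 2"
  have "?v \<noteq> 0"
    using frame_independent[of "g 2 2" "- g 1 2"] pos by auto
  then have "bilin G ?v ?v > 0"
    by (rule metric_pos)
  also have "bilin G ?v ?v = g 2 2 * detg"
    by (simp add: bilin_simps det_gram g_sym algebra_simps)
  finally show ?thesis
    using pos by (simp add: zero_less_mult_iff)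
qed

lemma matrix_inv_gram:
  "matrix_inv (gram G t) = (1 / detg) *\<^sub>R vector [vector [g 2 2, - g 1 2], vector [- g 1 2, g 1 1]]"
proof (rule matrix_inv_unique)
  show "gram G t ** ((1 / detg) *\<^sub>R vector [vector [g 2 2, - g 1 2], vector [- g 1 2, g 1 1]]) = mat 1"
    using det_gram_pos
    by (simp add: vec_eq_iff forall_2 matrix_matrix_mult_def sum_2 mat_def)
      (simp add: gram_nth g_sym divide_simps; simp add: det_gram algebra_simps)
qed

lemma inv_gram:
  "matrix_inv (gram G t) $ 1 $ 1 = g 2 2 / detg"
  "matrix_inv (gram G t) $ 1 $ 2 = - g 1 2 / detg"
  "matrix_inv (gram G t) $ 2 $ 1 = - g 1 2 / detg"
  "matrix_inv (gram G t) $ 2 $ 2 = g 1 1 / detg"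
  by (simp_all add: matrix_inv_gram)

lemma metric_frame_proj: "bilin G (frame_proj G t V) (t c) = bilin G V (t c)"
proof -
  have "\<forall>c. bilin G (frame_proj G t V) (t c) = bilin G V (t c)"
    using det_gram_pos
    by (simp add: forall_2 frame_proj_def frame_coord_def sum_2 bilin_simps inv_gram g_sym divide_simps)
       (simp add: det_gram algebra_simps)
  then show ?thesis ..
qed

lemma metric_frame_perp: "bilin G (frame_perp G t V) (t c) = 0"
  by (simp add: frame_perp_def bilin_simps metric_frame_proj)

lemma metric_eq_0: "bilin G U U = 0 \<Longrightarrow> U = 0"
  using metric_pos[of U] by fastforce

text \<open>The difference of the two sides lies in the span of the frame and is orthogonal to it,
  hence orthogonal to itself, and definiteness makes it vanish.\<close>

lemma frame_proj_unique:
  assumes "\<And>c. bilin G V (t c) = bilin G (x *\<^sub>R t 1 + y *\<^sub>R t 2) (t c)"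
  shows "frame_proj G t V = x *\<^sub>R t 1 + y *\<^sub>R t 2"
proof -
  let ?T = "frame_proj G t V - (x *\<^sub>R t 1 + y *\<^sub>R t 2)"
  have 0: "bilin G ?T (t c) = 0" for c
    using assms[of c] by (simp add: bilin_diff_left metric_frame_proj)
  have "bilin G ?T ((frame_coord G t 1 V - x) *\<^sub>R t 1 + (frame_coord G t 2 V - y) *\<^sub>R t 2) = 0"
    by (simp only: bilin_add_right bilin_scaleR_right 0 mult_zero_right add_0)
  moreover have "(frame_coord G t 1 V - x) *\<^sub>R t 1 + (frame_coord G t 2 V - y) *\<^sub>R t 2 = ?T"
    by (simp add: frame_proj_def sum_2 algebra_simps)
  ultimately have "?T = 0"
    using metric_eq_0[of ?T] by (metis (no_types))
  then show ?thesis by simp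
qed

end

section \<open>The symbol on a tangent plane\<close>

text \<open>Index raising. It turns the differential of a function into its surface gradient and a
  covector \<xi> into the vector whose length enters the symbol.\<close>

definition metric_sharp :: "real ^ 'n ^ 'n \<Rightarrow> (2 \<Rightarrow> real ^ 'n) \<Rightarrow> (2 \<Rightarrow> real) \<Rightarrow> real ^ 'n"
  where "metric_sharp G t d = (\<Sum>a\<in>UNIV. \<Sum>b\<in>UNIV. (matrix_inv (gram G t) $ a $ b * d b) *\<^sub>R t a)"

definition gram_deriv ::
    "real ^ 'n ^ 'n \<Rightarrow> (2 \<Rightarrow> real ^ 'n) \<Rightarrow> real ^ 'n ^ 'n \<Rightarrow> (2 \<Rightarrow> real ^ 'n) \<Rightarrow> 2 \<Rightarrow> 2 \<Rightarrow> real"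
  where "gram_deriv G t G' V a b = bilin G' (t a) (t b) + bilin G (V a) (t b) + bilin G (t a) (V b)"

definition frame_cos :: "real ^ 'n ^ 'n \<Rightarrow> real ^ 'n ^ 'n \<Rightarrow> real \<Rightarrow> (2 \<Rightarrow> real ^ 'n) \<Rightarrow> real"
  where "frame_cos \<omega> G s t = s * bilin \<omega> (t 1) (t 2) / sqrt (det (gram G t))"

text \<open>\<open>\<omega>'\<close>, \<open>G'\<close> and \<open>V\<close> are the derivatives of \<open>\<omega>\<close>, \<open>G\<close> and \<open>t\<close> in one and the same direction.\<close>

definition frame_cos_deriv ::
    "real ^ 'n ^ 'n \<Rightarrow> real ^ 'n ^ 'n \<Rightarrow> real \<Rightarrow> (2 \<Rightarrow> real ^ 'n) \<Rightarrow>
      real ^ 'n ^ 'n \<Rightarrow> real ^ 'n ^ 'n \<Rightarrow> (2 \<Rightarrow> real ^ 'n) \<Rightarrow> real"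
  where "frame_cos_deriv \<omega> G s t \<omega>' G' V =
    s * (bilin \<omega>' (t 1) (t 2) + bilin \<omega> (V 1) (t 2) + bilin \<omega> (t 1) (V 2)) / sqrt (det (gram G t))
    - frame_cos \<omega> G s t / (2 * det (gram G t)) *
      (gram_deriv G t G' V 1 1 * bilin G (t 2) (t 2) + bilin G (t 1) (t 1) * gram_deriv G t G' V 2 2
       - gram_deriv G t G' V 1 2 * bilin G (t 2) (t 1) - bilin G (t 1) (t 2) * gram_deriv G t G' V 2 1)"

text \<open>\<open>frame_cos_deriv\<close> is linear in the triple
  \<open>(\<omega>', G', V)\<close>, so the second derivatives of the surface, carried by
  \<open>V\<close>, separate from the first-order terms.\<close>

lemma frame_cos_deriv_split:
  "frame_cos_deriv \<omega> G s t \<omega>' G' V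
    = frame_cos_deriv \<omega> G s t 0 0 V + frame_cos_deriv \<omega> G s t \<omega>' G' (\<lambda>_. 0)"
  by (simp add: frame_cos_deriv_def gram_deriv_def algebra_simps add_divide_distrib diff_divide_distrib)

text \<open>The shape of the equation when the second derivatives \<open>K\<close> of the surface and the differential
  \<open>d\<close> of \<open>cos \<alpha>\<close> are treated as independent quantities.\<close>

definition frame_operator ::
    "real ^ 'n ^ 'n \<Rightarrow> real ^ 'n ^ 'n \<Rightarrow> real \<Rightarrow> (2 \<Rightarrow> real ^ 'n) \<Rightarrow>
      (2 \<Rightarrow> 2 \<Rightarrow> real ^ 'n) \<Rightarrow> (2 \<Rightarrow> real) \<Rightarrow> real ^ 'n"
  where "frame_operator \<omega> J s t K d =
    (let G = kaehler_metric \<omega> J in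
      frame_cos \<omega> G s t ^ 3 *\<^sub>R
        (\<Sum>a\<in>UNIV. \<Sum>b\<in>UNIV. (matrix_inv (gram G t) $ a $ b) *\<^sub>R frame_perp G t (K a b))
      - frame_perp G t (J *v frame_proj G t (J *v metric_sharp G t d)))"

lemma metric_sharp_add:
  "metric_sharp G t (\<lambda>a. d a + d' a) = metric_sharp G t d + metric_sharp G t d'"
  by (simp add: metric_sharp_def sum.distrib algebra_simps)

lemma metric_sharp_scale: "metric_sharp G t (\<lambda>a. r * d a) = r *\<^sub>R metric_sharp G t d"
  by (simp add: metric_sharp_def scaleR_sum_right algebra_simps)

text \<open>With the frame fixed, the expression is jointly linear in \<open>K\<close> and
  \<open>d\<close>; this is the source of quasilinearity.\<close>

lemma frame_operator_add:
  "frame_operator \<omega> J s t (\<lambda>a b. K a b + K' a b) (\<lambda>a. d a + d' a)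
    = frame_operator \<omega> J s t K d + frame_operator \<omega> J s t K' d'"
  by (simp add: frame_operator_def Let_def metric_sharp_add linear_add[OF linear_frame_perp]
      linear_add[OF linear_frame_proj] matrix_vector_right_distrib sum.distrib scaleR_add_right)

lemma frame_operator_scaleR:
  "frame_operator \<omega> J s t (\<lambda>a b. r *\<^sub>R K a b) (\<lambda>a. r * d a) = r *\<^sub>R frame_operator \<omega> J s t K d"
  by (simp add: frame_operator_def Let_def metric_sharp_scale linear_scale[OF linear_frame_perp]
      linear_scale[OF linear_frame_proj] matrix_vector_mult_scaleR scaleR_sum_right
      scaleR_diff_right mult_ac)

text \<open>The part of the equation carrying second derivatives. In direction \<open>b\<close> the
  frame moves by \<open>K b\<close>, while the derivatives of \<omega> and of the metric are of
  lower order and are set to zero.\<close>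

definition frame_principal ::
    "real ^ 'n ^ 'n \<Rightarrow> real ^ 'n ^ 'n \<Rightarrow> real \<Rightarrow> (2 \<Rightarrow> real ^ 'n) \<Rightarrow> (2 \<Rightarrow> 2 \<Rightarrow> real ^ 'n) \<Rightarrow> real ^ 'n"
  where "frame_principal \<omega> J s t K = frame_operator \<omega> J s t K
    (\<lambda>b. frame_cos_deriv \<omega> (kaehler_metric \<omega> J) s t 0 0 (K b))"

lemma frame_principal_add:
  "frame_principal \<omega> J s t (\<lambda>a b. K a b + K' a b)
    = frame_principal \<omega> J s t K + frame_principal \<omega> J s t K'"
proof -
  have "frame_cos_deriv \<omega> G s t 0 0 (\<lambda>b. V b + V' b)
      = frame_cos_deriv \<omega> G s t 0 0 V + frame_cos_deriv \<omega> G s t 0 0 V'" for G V V'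
    by (simp add: frame_cos_deriv_def gram_deriv_def bilin_simps algebra_simps
        add_divide_distrib diff_divide_distrib)
  then show ?thesis
    by (simp add: frame_principal_def flip: frame_operator_add)
qed

lemma frame_principal_scaleR:
  "frame_principal \<omega> J s t (\<lambda>a b. r *\<^sub>R K a b) = r *\<^sub>R frame_principal \<omega> J s t K"
proof -
  have "frame_cos_deriv \<omega> G s t 0 0 (\<lambda>b. r *\<^sub>R V b) = r * frame_cos_deriv \<omega> G s t 0 0 V" for G V
    by (simp add: frame_cos_deriv_def gram_deriv_def bilin_simps algebra_simps)
  then show ?thesis
    by (simp add: frame_principal_def flip: frame_operator_scaleR)
qed

text \<open>Every summand is a \<open>frame_perp\<close>, so nothing is lost when the value is later
  expanded in a normal frame.\<close>

lemma (in metric_frame) metric_frame_operator: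
  assumes "G = kaehler_metric \<omega> J"
  shows "bilin G (frame_operator \<omega> J s t K d) (t c) = 0"
  unfolding frame_operator_def Let_def assms[symmetric]
  by (simp add: sum_2 bilin_simps metric_frame_perp)

section \<open>Hermitian algebra of the symbol at a point\<close>

locale hermitian_frame = metric_frame "kaehler_metric \<omega> J" t
  for \<omega> J :: "real ^ 'n ^ 'n" and t :: "2 \<Rightarrow> real ^ 'n" +
  fixes s :: real
  assumes omega_skew: "bilin \<omega> U V = - bilin \<omega> V U"
    and J_square: "J *v (J *v U) = - U"
    and s_cases: "s \<in> {1, -1}"
    and cos_pos: "frame_cos \<omega> (kaehler_metric \<omega> J) s t > 0"
begin

abbreviation "G \<equiv> kaehler_metric \<omega> J"

abbreviation "ca \<equiv> frame_cos \<omega> G s t"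

lemma metric_omega: "bilin G U V = bilin \<omega> U (J *v V)"
  by (simp add: bilin_def kaehler_metric_def matrix_vector_mul_assoc)

text \<open>Symmetry of the metric moves \<open>J\<close> into the second slot, where its square is
  -1.\<close>

lemma metric_J: "bilin G (J *v U) V = bilin \<omega> U V"
proof -
  have "bilin G (J *v U) V = bilin G V (J *v U)"
    by (rule metric_sym)
  also have "\<dots> = - bilin \<omega> V U"
    by (simp add: metric_omega J_square bilin_simps)
  also have "\<dots> = bilin \<omega> U V"
    using omega_skew[of V U] by simp
  finally show ?thesis .
qed

lemma omega_frame_self: "bilin \<omega> U U = 0"
  using omega_skew[of U U] by simp

lemma s_square: "s * s = 1"
  using s_cases by auto

text \<open>The vector \<open>metric_sharp G t \<xi>\<close> after a quarter turn in the oriented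
  plane. The factor \<open>s / sqrt detg\<close> allows for frames that are not orthonormal or not
  positively oriented.\<close>

definition rot :: "(2 \<Rightarrow> real) \<Rightarrow> real ^ 'n"
  where "rot \<xi> = (s / sqrt detg) *\<^sub>R (\<xi> 1 *\<^sub>R t 2 - \<xi> 2 *\<^sub>R t 1)"

lemma metric_sharp_eq: "metric_sharp G t \<xi> =
    ((g 2 2 * \<xi> 1 - g 1 2 * \<xi> 2) / detg) *\<^sub>R t 1 + ((g 1 1 * \<xi> 2 - g 1 2 * \<xi> 1) / detg) *\<^sub>R t 2"
  by (simp add: metric_sharp_def sum_2 inv_gram algebra_simps diff_divide_distrib)

lemma metric_sharp_inner: "bilin G (metric_sharp G t \<xi>) (t c) = \<xi> c"
proof -
  have "\<forall>c. bilin G (metric_sharp G t \<xi>) (t c) = \<xi> c"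
    using det_gram_pos by (simp add: forall_2 metric_sharp_eq bilin_simps g_sym divide_simps)
      (simp add: det_gram algebra_simps)
  then show ?thesis ..
qed

text \<open>On the plane \<omega> is cos \<alpha> times the oriented area form, so the tangential
  part of \<open>J\<close> is cos \<alpha> times the quarter turn.\<close>

lemma frame_proj_J_sharp: "frame_proj G t (J *v metric_sharp G t \<xi>) = ca *\<^sub>R rot \<xi>"
proof -
  have sq: "sqrt detg * sqrt detg = detg" "sqrt detg > 0"
    using det_gram_pos by simp_all
  \<comment> \<open>The coefficient of the rotated covector on the frame; \<open>s * s = 1\<close>
    frees it of the sign and the root.\<close>
  let ?k = "ca * s / sqrt detg"
  have k: "?k = bilin \<omega> (t 1) (t 2) / detg"
    using sq s_square det_gram_pos unfolding frame_cos_def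
    by (simp add: field_simps)
  have "\<forall>c. bilin G (J *v metric_sharp G t \<xi>) (t c)
      = bilin G ((- ?k * \<xi> 2) *\<^sub>R t 1 + (?k * \<xi> 1) *\<^sub>R t 2) (t c)"
    unfolding k using det_gram_pos omega_skew[of "t 2" "t 1"]
    by (simp add: forall_2 metric_J metric_sharp_eq bilin_simps omega_frame_self g_sym divide_simps)
       (simp add: det_gram algebra_simps)
  then have "frame_proj G t (J *v metric_sharp G t \<xi>) = (- ?k * \<xi> 2) *\<^sub>R t 1 + (?k * \<xi> 1) *\<^sub>R t 2"
    by (intro frame_proj_unique) blast
  then show ?thesis
    by (simp add: rot_def algebra_simps)
qed

text \<open>Two quarter turns give -1, so the tangential part of \<open>J *v rot \<xi>\<close> is
  minus cos \<alpha> times \<open>metric_sharp G t \<xi>\<close>.\<close>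

lemma frame_perp_J_rot: "frame_perp G t (J *v rot \<xi>) = J *v rot \<xi> + ca *\<^sub>R metric_sharp G t \<xi>"
proof -
  let ?c = "ca / detg"
  have "\<forall>c. bilin G (J *v rot \<xi>) (t c) = - ca * \<xi> c"
    unfolding frame_cos_def using omega_skew[of "t 2" "t 1"]
    by (simp add: forall_2 metric_J rot_def bilin_simps omega_frame_self)
  then have "bilin G (J *v rot \<xi>) (t c) = bilin G (- ca *\<^sub>R metric_sharp G t \<xi>) (t c)" for c
    by (simp only: bilin_scaleR_left metric_sharp_inner)
  moreover have "- ca *\<^sub>R metric_sharp G t \<xi> =
      (- ?c * (g 2 2 * \<xi> 1 - g 1 2 * \<xi> 2)) *\<^sub>R t 1 + (- ?c * (g 1 1 * \<xi> 2 - g 1 2 * \<xi> 1)) *\<^sub>R t 2"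
    by (simp add: metric_sharp_eq algebra_simps add_divide_distrib diff_divide_distrib)
  ultimately have "frame_proj G t (J *v rot \<xi>) = - ca *\<^sub>R metric_sharp G t \<xi>"
    using frame_proj_unique by metis
  then show ?thesis
    by (simp add: frame_perp_def)
qed

text \<open>Up to the factor \<open>\<xi> c\<close>, the numerator of the cosine contributes
  \<open>- bilin G V (J *v rot \<xi>)\<close> and the area element
  \<open>- ca * bilin G V (metric_sharp G t \<xi>)\<close>; by \<open>frame_perp_J_rot\<close> they
  add up to a pairing with a normal vector.\<close>

lemma frame_cos_deriv_symbol:
  "frame_cos_deriv \<omega> G s t 0 0 (\<lambda>a. (\<xi> c * \<xi> a) *\<^sub>R V)
    = - \<xi> c * bilin G (frame_perp G t V) (frame_perp G t (J *v rot \<xi>))"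
proof -
  let ?P = "frame_perp G t (J *v rot \<xi>)"
  \<comment> \<open>The tangential part of \<open>V\<close> may be restored here because
    \<open>?P\<close> is normal.\<close>
  have "bilin G (frame_perp G t V) ?P = bilin G V ?P - bilin G ?P (frame_proj G t V)"
    by (simp add: frame_perp_def[of G t V] bilin_diff_left metric_sym[of ?P])
  also have "bilin G ?P (frame_proj G t V) = 0"
    by (simp add: frame_proj_def sum_2 bilin_simps metric_frame_perp)
  finally have "bilin G (frame_perp G t V) ?P = bilin G V (J *v rot \<xi>) + ca * bilin G V (metric_sharp G t \<xi>)"
    by (simp add: frame_perp_J_rot bilin_simps)
  also have "bilin G V (J *v rot \<xi>) = - bilin \<omega> V (rot \<xi>)"
    by (simp add: metric_omega J_square bilin_simps)
  also have "bilin \<omega> V (rot \<xi>) = s * (\<xi> 1 * bilin \<omega> V (t 2) + \<xi> 2 * bilin \<omega> (t 1) V) / sqrt detg"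
    using omega_skew[of V "t 1"] by (simp add: rot_def bilin_simps)
  finally have m: "bilin G (frame_perp G t V) ?P = ca * bilin G V (metric_sharp G t \<xi>)
      - s * (\<xi> 1 * bilin \<omega> V (t 2) + \<xi> 2 * bilin \<omega> (t 1) V) / sqrt detg"
    by simp
  let ?V = "\<lambda>a. (\<xi> c * \<xi> a) *\<^sub>R V"
  \<comment> \<open>Jacobi's formula for the derivative of the Gram determinant; the factor 2
    cancels the one from differentiating the square root.\<close>
  have "gram_deriv G t 0 ?V 1 1 * g 2 2 + g 1 1 * gram_deriv G t 0 ?V 2 2
      - gram_deriv G t 0 ?V 1 2 * g 2 1 - g 1 2 * gram_deriv G t 0 ?V 2 1
      = 2 * \<xi> c * (detg * bilin G V (metric_sharp G t \<xi>))"
    using det_gram_pos metric_sym[of V "t 1"] metric_sym[of V "t 2"]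
    by (simp add: gram_deriv_def metric_sharp_eq bilin_simps g_sym divide_simps)
       (simp add: algebra_simps)
  then show ?thesis
    unfolding frame_cos_deriv_def m using det_gram_pos
    by (simp add: bilin_simps algebra_simps add_divide_distrib)
qed

text \<open>On the symbol variation the differential of cos \<alpha> is a multiple of \<xi>. The
  scalar passes through the linear operators, which send \<xi> to
  \<open>ca *\<^sub>R frame_perp G t (J *v rot \<xi>)\<close>, and its minus sign cancels the one in
  the equation.\<close>

lemma frame_principal_symbol:
  "frame_principal \<omega> J s t (\<lambda>a b. (\<xi> a * \<xi> b) *\<^sub>R V) =
    (ca ^ 3 * bilin G (metric_sharp G t \<xi>) (metric_sharp G t \<xi>)) *\<^sub>R frame_perp G t V
    + (ca * bilin G (frame_perp G t V) (frame_perp G t (J *v rot \<xi>))) *\<^sub>R frame_perp G t (J *v rot \<xi>)"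
proof -
  \<comment> \<open>The trace of the tensor square of \<xi> is the squared length of \<xi>.\<close>
  have 1: "(\<Sum>a\<in>UNIV. \<Sum>b\<in>UNIV. matrix_inv (gram G t) $ a $ b *\<^sub>R frame_perp G t ((\<xi> a * \<xi> b) *\<^sub>R V))
      = bilin G (metric_sharp G t \<xi>) (metric_sharp G t \<xi>) *\<^sub>R frame_perp G t V"
  proof -
    have "bilin G (metric_sharp G t \<xi>) (metric_sharp G t \<xi>)
        = (\<Sum>a\<in>UNIV. \<Sum>b\<in>UNIV. matrix_inv (gram G t) $ a $ b * (\<xi> a * \<xi> b))"
      by (subst (2) metric_sharp_def) (simp add: sum_2 bilin_simps metric_sharp_inner algebra_simps)
    then show ?thesis
      by (simp add: linear_scale[OF linear_frame_perp] scaleR_sum_left)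
  qed
  define m where "m = bilin G (frame_perp G t V) (frame_perp G t (J *v rot \<xi>))"
  have 2: "(\<lambda>b. frame_cos_deriv \<omega> G s t 0 0 (\<lambda>a. (\<xi> b * \<xi> a) *\<^sub>R V)) = (\<lambda>b. (- m) * \<xi> b)"
    by (simp add: frame_cos_deriv_symbol m_def mult.commute)
  show ?thesis
    unfolding frame_principal_def frame_operator_def Let_def 1 2 metric_sharp_scale
    by (simp add: matrix_vector_mult_scaleR linear_scale[OF linear_frame_proj] frame_proj_J_sharp
        linear_scale[OF linear_frame_perp] flip: m_def scaleR_minus_left)
qed

text \<open>A tangential \<open>V\<close> is annihilated by the symbol, hence the hypothesis on the
  normal part. Pairing with that part turns the second summand of the symbol into a square.\<close>

lemma frame_principal_nonzero:
  assumes "\<xi> c \<noteq> 0" and "frame_perp G t V \<noteq> 0"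
  shows "frame_principal \<omega> J s t (\<lambda>a b. (\<xi> a * \<xi> b) *\<^sub>R V) \<noteq> 0"
proof
  assume 0: "frame_principal \<omega> J s t (\<lambda>a b. (\<xi> a * \<xi> b) *\<^sub>R V) = 0"
  let ?N = "frame_perp G t V" and ?P = "frame_perp G t (J *v rot \<xi>)" and ?X = "metric_sharp G t \<xi>"
  have "?X \<noteq> 0"
    using metric_sharp_inner[of \<xi> c] assms(1) by auto
  then have "ca ^ 3 * bilin G ?X ?X * bilin G ?N ?N > 0"
    using cos_pos metric_pos assms(2) by simp
  moreover have "ca * (bilin G ?N ?P)\<^sup>2 \<ge> 0"
    using cos_pos by simp
  moreover have "ca ^ 3 * bilin G ?X ?X * bilin G ?N ?N + ca * (bilin G ?N ?P)\<^sup>2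
      = bilin G (frame_principal \<omega> J s t (\<lambda>a b. (\<xi> a * \<xi> b) *\<^sub>R V)) ?N"
    unfolding frame_principal_symbol
    by (simp add: bilin_simps power2_eq_square metric_sym[of ?P])
  ultimately show False
    unfolding 0 by simp
qed

end

section \<open>Derivatives along a parametrized surface\<close>

lemma bounded_bilinear_matrix_vector_mult:
  "bounded_bilinear (\<lambda>(A :: real ^ 'n ^ 'm) x. A *v x)"
  unfolding bilinear_conv_bounded_bilinear[symmetric] bilinear_def
  by (auto intro!: linearI simp: matrix_vector_mult_add_rdistrib matrix_vector_right_distrib
      matrix_vector_mult_scaleR scaleR_matrix_vector_assoc)

lemma bounded_bilinear_matrix_mult:
  "bounded_bilinear (\<lambda>(A :: real ^ 'n ^ 'm) (B :: real ^ 'k ^ 'n). A ** B)"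
  unfolding bilinear_conv_bounded_bilinear[symmetric] bilinear_def
  by (auto intro!: linearI simp: vec_eq_iff matrix_matrix_mult_def algebra_simps sum.distrib
      sum_distrib_left)

lemma has_derivative_bilin:
  fixes A :: "'a::real_normed_vector \<Rightarrow> real ^ 'n ^ 'n"
  assumes "(A has_derivative A') (at z)" "(U has_derivative U') (at z)" "(V has_derivative V') (at z)"
  shows "((\<lambda>z. bilin (A z) (U z) (V z)) has_derivative
    (\<lambda>h. bilin (A' h) (U z) (V z) + bilin (A z) (U' h) (V z) + bilin (A z) (U z) (V' h))) (at z)"
  unfolding bilin_def
  by (rule has_derivative_eq_rhs,
      rule has_derivative_inner[OF assms(2)
        bounded_bilinear.FDERIV[OF bounded_bilinear_matrix_vector_mult assms(1,3)]])
    (simp add: fun_eq_iff inner_add_right)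

text \<open>Quotient rule, with the product rule in the numerator and the expanded 2 by 2
  determinant under the root. Positivity of the determinant makes the root differentiable.\<close>

lemma has_derivative_frame_cos:
  fixes \<Omega> \<Gamma> :: "'a::real_normed_vector \<Rightarrow> real ^ 'n ^ 'n"
  assumes \<Omega>: "(\<Omega> has_derivative \<Omega>') (at z)" and \<Gamma>: "(\<Gamma> has_derivative \<Gamma>') (at z)"
    and T: "\<And>a. (T a has_derivative T' a) (at z)"
    and pos: "det (gram (\<Gamma> z) (\<lambda>a. T a z)) > 0"
  shows "((\<lambda>y. frame_cos (\<Omega> y) (\<Gamma> y) s (\<lambda>a. T a y)) has_derivative
    (\<lambda>h. frame_cos_deriv (\<Omega> z) (\<Gamma> z) s (\<lambda>a. T a z) (\<Omega>' h) (\<Gamma>' h) (\<lambda>a. T' a h))) (at z)"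
proof -
  let ?g = "\<lambda>a b y. bilin (\<Gamma> y) (T a y) (T b y)"
  let ?g' = "\<lambda>a b h. gram_deriv (\<Gamma> z) (\<lambda>a. T a z) (\<Gamma>' h) (\<lambda>a. T' a h) a b"
  have g: "(?g a b has_derivative ?g' a b) (at z)" for a b
    unfolding gram_deriv_def by (rule has_derivative_bilin[OF \<Gamma> T T])
  let ?D = "\<lambda>y. det (gram (\<Gamma> y) (\<lambda>a. T a y))"
  let ?D' = "\<lambda>h. ?g' 1 1 h * ?g 2 2 z + ?g 1 1 z * ?g' 2 2 h - ?g' 1 2 h * ?g 2 1 z - ?g 1 2 z * ?g' 2 1 h"
  have D: "(?D has_derivative ?D') (at z)"
    unfolding det_2 gram_nth
    by (rule has_derivative_eq_rhs, (rule derivative_intros g)+) (simp add: fun_eq_iff)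
  let ?n = "\<lambda>y. s * bilin (\<Omega> y) (T 1 y) (T 2 y)"
  let ?n' = "\<lambda>h. s * (bilin (\<Omega>' h) (T 1 z) (T 2 z) + bilin (\<Omega> z) (T' 1 h) (T 2 z)
    + bilin (\<Omega> z) (T 1 z) (T' 2 h))"
  have n: "(?n has_derivative ?n') (at z)"
    by (intro has_derivative_mult_right has_derivative_bilin \<Omega> T)
  have r: "((\<lambda>y. sqrt (?D y)) has_derivative (\<lambda>h. ?D' h * (inverse (sqrt (?D z)) / 2))) (at z)"
    by (rule has_derivative_real_sqrt[OF pos D])
  have "sqrt (?D z) \<noteq> 0"
    using pos by simp
  from has_derivative_divide'[OF n r this] show ?thesis
    unfolding frame_cos_def
  proof (rule has_derivative_eq_rhs)
    \<comment> \<open>Here \<open>q\<close> is the root of the Gram determinant, \<open>m\<close>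
      the numerator and \<open>d\<close> the derivative of the determinant, so \<open>m / q\<close>
      is the cosine itself.\<close>
    have "(x * q - m * (d * (inverse q / 2))) / (q * q) = x / q - m / q / (2 * (q * q)) * d"
      if "q > 0" for x q m d :: real
      using that by (simp add: field_simps)
    from this[of "sqrt (?D z)"] pos
    show "(\<lambda>h. (?n' h * sqrt (?D z) - ?n z * (?D' h * (inverse (sqrt (?D z)) / 2)))
        / (sqrt (?D z) * sqrt (?D z)))
      = (\<lambda>h. frame_cos_deriv (\<Omega> z) (\<Gamma> z) s (\<lambda>a. T a z) (\<Omega>' h) (\<Gamma>' h) (\<lambda>a. T' a h))"
      unfolding frame_cos_deriv_def frame_cos_def by (auto simp: fun_eq_iff)
  qed
qed

section \<open>Dictionary between surface quantities and the algebra of frames\<close>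

lemma induced_metric_eq: "induced_metric G F z = gram (G (F z)) (\<lambda>a. tang F a z)"
  by (simp add: induced_metric_def gram_def)

lemma tan_part_eq: "tan_part G F z = frame_proj (G (F z)) (\<lambda>a. tang F a z)"
  by (simp add: fun_eq_iff tan_part_def frame_proj_def frame_coord_def induced_inv_def
      induced_metric_eq scaleR_sum_left)

lemma nor_part_eq: "nor_part G F z = frame_perp (G (F z)) (\<lambda>a. tang F a z)"
  by (simp add: fun_eq_iff nor_part_def frame_perp_def tan_part_eq)

lemma surface_gradient_eq:
  "surface_gradient G F h z
    = metric_sharp (G (F z)) (\<lambda>a. tang F a z) (\<lambda>b. dirderiv (axis b 1) h z)"
  by (simp add: surface_gradient_def metric_sharp_def induced_inv_def induced_metric_eq)

lemma cos_kaehler_angle_eq: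
  "cos_kaehler_angle \<omega> J s F z
    = frame_cos (\<omega> (F z)) (metric_field \<omega> J (F z)) s (\<lambda>a. tang F a z)"
  by (simp add: cos_kaehler_angle_def frame_cos_def induced_metric_eq)

lemma dirderiv_eq: "(f has_derivative f') (at x) \<Longrightarrow> dirderiv v f x = f' v"
  unfolding dirderiv_def by (metis frechet_derivative_at)

lemma has_derivative_dirderiv:
  "f differentiable (at x) \<Longrightarrow> (f has_derivative (\<lambda>v. dirderiv v f x)) (at x)"
  unfolding dirderiv_def by (simp add: frechet_derivative_works)

text \<open>The first summand is linear in the second derivatives of \<open>F\<close>; the second
  depends on position and tangent vectors alone and collects the Christoffel terms and the
  derivatives of \<omega> and of the metric.\<close>

lemma surface_operator_eq:
  fixes F :: surf
  defines "t \<equiv> \<lambda>z a. tang F a z"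
  assumes F: "F differentiable (at z)" and T: "\<And>a. tang F a differentiable (at z)"
    and \<omega>: "\<omega> differentiable (at (F z))" and G: "metric_field \<omega> J differentiable (at (F z))"
    and pos: "det (gram (metric_field \<omega> J (F z)) (t z)) > 0"
  shows "surface_operator \<omega> J s F z =
    frame_principal (\<omega> (F z)) (J (F z)) s (t z) (\<lambda>a b. dirderiv (axis a 1) (tang F b) z)
    + frame_operator (\<omega> (F z)) (J (F z)) s (t z)
        (\<lambda>a b. christoffel (metric_field \<omega> J) (F z) (t z a) (t z b))
        (\<lambda>b. frame_cos_deriv (\<omega> (F z)) (metric_field \<omega> J (F z)) s (t z)
          (dirderiv (t z b) \<omega> (F z)) (dirderiv (t z b) (metric_field \<omega> J) (F z)) (\<lambda>_. 0))"
proof -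
  \<comment> \<open>Chain rule: along \<open>F\<close> an ambient field is differentiated in the
    direction of the pushed-forward vector, which for a coordinate direction is a tangent vector of
    the frame.\<close>
  have comp: "((\<lambda>y. f (F y)) has_derivative (\<lambda>h. dirderiv (dirderiv h F z) f (F z))) (at z)"
    if "f differentiable (at (F z))" for f :: "real ^ 4 \<Rightarrow> real ^ 4 ^ 4"
    using has_derivative_compose[OF has_derivative_dirderiv[OF F] has_derivative_dirderiv[OF that]] .
  have "dirderiv (axis b 1) (cos_kaehler_angle \<omega> J s F) z
      = frame_cos_deriv (\<omega> (F z)) (metric_field \<omega> J (F z)) s (t z)
          (dirderiv (t z b) \<omega> (F z)) (dirderiv (t z b) (metric_field \<omega> J) (F z))
          (\<lambda>a. dirderiv (axis b 1) (tang F a) z)" for b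
    unfolding cos_kaehler_angle_eq[abs_def] t_def
    using dirderiv_eq[OF has_derivative_frame_cos[OF comp[OF \<omega>] comp[OF G]
        has_derivative_dirderiv[OF T] pos[unfolded t_def]]]
    by (simp add: tang_def)
  then have *: "dirderiv (axis b 1) (cos_kaehler_angle \<omega> J s F) z
      = frame_cos_deriv (\<omega> (F z)) (metric_field \<omega> J (F z)) s (t z) 0 0
          (\<lambda>a. dirderiv (axis b 1) (tang F a) z)
      + frame_cos_deriv (\<omega> (F z)) (metric_field \<omega> J (F z)) s (t z)
          (dirderiv (t z b) \<omega> (F z)) (dirderiv (t z b) (metric_field \<omega> J) (F z)) (\<lambda>_. 0)" for b
    using frame_cos_deriv_split by metis
  have "surface_operator \<omega> J s F z = frame_operator (\<omega> (F z)) (J (F z)) s (t z)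
      (\<lambda>a b. dirderiv (axis a 1) (tang F b) z + christoffel (metric_field \<omega> J) (F z) (t z a) (t z b))
      (\<lambda>b. dirderiv (axis b 1) (cos_kaehler_angle \<omega> J s F) z)"
    by (simp add: surface_operator_def frame_operator_def Let_def mean_curvature_def t_def
        second_fundamental_form_def nor_part_eq tan_part_eq surface_gradient_eq induced_inv_def
        induced_metric_eq metric_field_def cos_kaehler_angle_eq)
  then show ?thesis
    by (simp add: * frame_operator_add frame_principal_def metric_field_def)
qed

section \<open>Charts and graphs\<close>

lemma smooth_on_differentiable:
  assumes "smooth_on S f" and "x \<in> S"
  shows "f differentiable (at x)"
  using assms unfolding smooth_on_def by (metis Ck_on.simps(2))

lemma smooth_on_dirderiv:
  assumes "smooth_on S f"
  shows "smooth_on S (dirderiv v f)"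
  using assms unfolding smooth_on_def by (metis Ck_on.simps(2))

section \<open>Transition maps and the square of \<open>J\<close>\<close>

lemma chart_inv_chart:
  assumes "is_chart M c" and "p \<in> fst c"
  shows "chart_inv c (snd c p) = p"
proof -
  have "inj_on (snd c) (fst c)"
    using homeomorphic_imp_injective_map[of "subtopology M (fst c)"] assms(1)
      openin_subset[of M "fst c"] by (auto simp: is_chart_def Int_absorb1)
  then show ?thesis
    using assms(2) by (simp add: chart_inv_def)
qed

lemma open_overlap:
  assumes "is_chart M c" and "is_chart M d"
  shows "open (overlap c d)"
proof -
  have "open_map (subtopology M (fst c)) (top_of_set (chart_image c)) (snd c)"
    using assms(1) by (simp add: is_chart_def homeomorphic_imp_open_map)
  moreover have "openin (subtopology M (fst c)) (fst c \<inter> fst d)"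
    using assms(2) by (simp add: is_chart_def openin_subtopology_Int2)
  ultimately have "openin (top_of_set (chart_image c)) (overlap c d)"
    unfolding overlap_def open_map_def by blast
  then show ?thesis
    using assms(1) openin_open_trans by (auto simp: is_chart_def)
qed

text \<open>The transition maps are mutually inverse on the overlap. Since the overlap is open,
  their composition has the derivative of the identity there, and the chain rule applies.\<close>

lemma transition_jacobian_left_inverse:
  assumes c: "is_chart M c" and d: "is_chart M d" and cd: "compatible_charts c d"
    and x: "x \<in> overlap c d"
  shows "jacobian (transition d c) (at (transition c d x)) ** jacobian (transition c d) (at x) = mat 1"
    (is "?D' ** ?D = _")
proof -
  have inverse: "transition d c (transition c d y) = y \<and> transition c d y \<in> overlap d c"
    if "y \<in> overlap c d" for y
    using that chart_inv_chart[OF c] chart_inv_chart[OF d]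
    by (auto simp: overlap_def transition_def)
  have "(transition c d has_derivative (\<lambda>h. ?D *v h)) (at x)"
    using cd x smooth_on_differentiable unfolding compatible_charts_def jacobian_works[symmetric] by blast
  moreover have "(transition d c has_derivative (\<lambda>h. ?D' *v h)) (at (transition c d x))"
    using cd inverse[OF x] smooth_on_differentiable
    unfolding compatible_charts_def jacobian_works[symmetric] by blast
  ultimately have "((\<lambda>y. transition d c (transition c d y)) has_derivative (\<lambda>h. ?D' *v (?D *v h))) (at x)"
    by (rule has_derivative_compose)
  then have "((\<lambda>y. y) has_derivative (\<lambda>h. ?D' *v (?D *v h))) (at x)"
    by (rule has_derivative_transform_within_open[OF _ open_overlap[OF c d] x]) (simp add: inverse)
  then have "(\<lambda>h. ?D' *v (?D *v h)) = (\<lambda>h. h)"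
    by (rule has_derivative_unique) (rule has_derivative_ident)
  then show ?thesis
    by (simp add: matrix_eq matrix_vector_mul_assoc fun_eq_iff)
qed

lemma vector_4 [simp]:
  "(vector [x, y, z, w] :: 'a::zero ^ 4) $ 1 = x"
  "(vector [x, y, z, w] :: 'a::zero ^ 4) $ 2 = y"
  "(vector [x, y, z, w] :: 'a::zero ^ 4) $ 3 = z"
  "(vector [x, y, z, w] :: 'a::zero ^ 4) $ 4 = w"
  unfolding vector_def by simp_all

lemma J_std_square: "J_std *v (J_std *v U) = - U"
  by (simp add: vec_eq_iff forall_4 matrix_vector_mult_def sum_4 J_std_def)

text \<open>The identity holds for \<open>J_std\<close>, hence in a chart \<open>d\<close> around
  the point where \<open>J\<close> is standard. The Jacobian \<open>D\<close> intertwines the two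
  matrices and is cancelled by its left inverse.\<close>

lemma complex_structure_square:
  assumes M: "smooth_manifold M \<A>" and J: "complex_structure M \<A> J"
    and c: "c \<in> \<A>" and x: "x \<in> chart_image c"
  shows "J c x *v (J c x *v U) = - U"
proof -
  obtain p where p: "p \<in> fst c" "x = snd c p"
    using x by (auto simp: chart_image_def)
  have "p \<in> topspace M"
    using M c p by (auto simp: smooth_manifold_def)
  then obtain d where d: "d \<in> \<A>" "p \<in> fst d" "\<And>y. y \<in> chart_image d \<Longrightarrow> J d y = J_std"
    using J unfolding complex_structure_def by blast
  have charts: "is_chart M c" "is_chart M d" "compatible_charts c d"
    using M c d by (auto simp: smooth_manifold_def)
  have ov: "x \<in> overlap c d"
    using p d by (auto simp: overlap_def)
  define D where "D = jacobian (transition c d) (at x)"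
  define D' where "D' = jacobian (transition d c) (at (transition c d x))"
  have D'D: "D' ** D = mat 1"
    using transition_jacobian_left_inverse[OF charts ov] by (simp add: D_def D'_def)
  have "transition c d x \<in> chart_image d"
    using p d chart_inv_chart[OF charts(1)] by (auto simp: transition_def chart_image_def)
  then have comm: "D ** J c x = J_std ** D"
    using J c d ov unfolding complex_structure_def endomorphism_tensor_def D_def Let_def by metis
  have "D *v (J c x *v (J c x *v U)) = J_std *v (J_std *v (D *v U))"
    using comm by (metis matrix_vector_mul_assoc)
  also have "\<dots> = D *v (- U)"
    by (simp add: J_std_square linear_neg[OF matrix_vector_mul_linear])
  finally have "D' *v (D *v (J c x *v (J c x *v U))) = D' *v (D *v (- U))"
    by simp
  moreover have "D' *v (D *v v) = v" for v
    by (simp add: matrix_vector_mul_assoc D'D)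
  ultimately show ?thesis
    by simp
qed

section \<open>Graphs and their first-order jets\<close>

definition graph_vec :: "real ^ 2 \<Rightarrow> real ^ 2 \<Rightarrow> real ^ 4"
  where "graph_vec y w = vector [y $ 1, y $ 2, w $ 1, w $ 2]"

lemma graph_vec_nth [simp]:
  "graph_vec y w $ 1 = y $ 1" "graph_vec y w $ 2 = y $ 2"
  "graph_vec y w $ 3 = w $ 1" "graph_vec y w $ 4 = w $ 2"
  by (simp_all add: graph_vec_def)

lemma graph_vec_add: "graph_vec (y + y') (w + w') = graph_vec y w + graph_vec y' w'"
  by (simp add: vec_eq_iff forall_4)

lemma graph_vec_scaleR: "graph_vec (r *\<^sub>R y) (r *\<^sub>R w) = r *\<^sub>R graph_vec y w"
  by (simp add: vec_eq_iff forall_4)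

lemma bounded_linear_graph_vec: "bounded_linear (\<lambda>p. graph_vec (fst p) (snd p))"
  by (intro linear_conv_bounded_linear[THEN iffD1] linearI)
    (simp_all add: graph_vec_add graph_vec_scaleR)

lemma has_derivative_graph_vec:
  assumes "(y has_derivative y') (at z)" "(w has_derivative w') (at z)"
  shows "((\<lambda>x. graph_vec (y x) (w x)) has_derivative (\<lambda>h. graph_vec (y' h) (w' h))) (at z)"
  using bounded_linear.has_derivative[OF bounded_linear_graph_vec has_derivative_Pair[OF assms]]
  by simp

lemma graph_eq: "graph u = (\<lambda>z. graph_vec z (u z))"
  by (simp add: fun_eq_iff graph_def graph_vec_def)

lemma has_derivative_graph:
  assumes "u differentiable (at z)"
  shows "(graph u has_derivative (\<lambda>h. graph_vec h (dirderiv h u z))) (at z)"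
  unfolding graph_eq
  by (rule has_derivative_graph_vec[OF has_derivative_ident has_derivative_dirderiv[OF assms]])

lemma tang_graph:
  assumes "u differentiable (at z)"
  shows "tang (graph u) a z = graph_vec (axis a 1) (dirderiv (axis a 1) u z)"
  unfolding tang_def by (rule dirderiv_eq[OF has_derivative_graph[OF assms]])

text \<open>The base components of a tangent vector are constant, so second derivatives of a graph
  are vertical.\<close>

lemma has_derivative_tang_graph:
  assumes "open W" "smooth_on W u" "z \<in> W"
  shows "(tang (graph u) a has_derivative
    (\<lambda>h. graph_vec 0 (dirderiv h (dirderiv (axis a 1) u) z))) (at z)"
proof (rule has_derivative_transform_within_open[OF _ assms(1,3)])
  show "((\<lambda>x. graph_vec (axis a 1) (dirderiv (axis a 1) u x)) has_derivative
      (\<lambda>h. graph_vec 0 (dirderiv h (dirderiv (axis a 1) u) z))) (at z)"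
    using assms smooth_on_dirderiv smooth_on_differentiable
    by (intro has_derivative_graph_vec has_derivative_const has_derivative_dirderiv) blast
qed (use assms tang_graph smooth_on_differentiable in metis)

lemma jacobian_axis:
  fixes u :: "real ^ 'n \<Rightarrow> real ^ 'm"
  assumes "u differentiable (at z)"
  shows "jacobian u (at z) *v axis a 1 = dirderiv (axis a 1) u z"
  using jacobian_works[THEN iffD1, OF assms] by (metis dirderiv_eq)

text \<open>Point and tangent frame are read off from the jet, so coefficients built from them
  depend on position and first derivatives only.\<close>

definition jet_point :: "jet1 \<Rightarrow> real ^ 4"
  where "jet_point q = graph_vec (fst q) (fst (snd q))"

definition jet_tang :: "jet1 \<Rightarrow> 2 \<Rightarrow> real ^ 4"
  where "jet_tang q a = graph_vec (axis a 1) (snd (snd q) *v axis a 1)"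

lemma jet_point_jet1_of: "jet_point (jet1_of u z) = graph u z"
  by (simp add: jet_point_def jet1_of_def graph_eq)

lemma jet_tang_jet1_of:
  "u differentiable (at z) \<Longrightarrow> jet_tang (jet1_of u z) = (\<lambda>a. tang (graph u) a z)"
  by (simp add: fun_eq_iff jet_tang_def jet1_of_def jacobian_axis tang_graph)

lemma jet_tang_independent:
  assumes "a *\<^sub>R jet_tang q 1 + b *\<^sub>R jet_tang q 2 = 0"
  shows "a = 0 \<and> b = 0"
proof -
  have "(a *\<^sub>R jet_tang q 1 + b *\<^sub>R jet_tang q 2) $ 1 = 0" "(a *\<^sub>R jet_tang q 1 + b *\<^sub>R jet_tang q 2) $ 2 = 0"
    by (simp_all add: assms)
  then show ?thesis
    by (simp add: jet_tang_def axis_def)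
qed

text \<open>Vertical vectors are transversal to the tangent plane of a graph: the first two
  components force both coefficients to vanish.\<close>

lemma graph_vec_0_eq_jet_tang:
  assumes "graph_vec 0 w = a *\<^sub>R jet_tang q 1 + b *\<^sub>R jet_tang q 2"
  shows "w = 0"
proof -
  have "(a *\<^sub>R jet_tang q 1 + b *\<^sub>R jet_tang q 2) $ 1 = 0" "(a *\<^sub>R jet_tang q 1 + b *\<^sub>R jet_tang q 2) $ 2 = 0"
    by (simp_all flip: assms)
  then have "graph_vec 0 w = 0"
    using assms by (simp add: jet_tang_def axis_def)
  then have "graph_vec 0 w $ 3 = 0" "graph_vec 0 w $ 4 = 0"
    by simp_all
  then show ?thesis
    by (simp add: vec_eq_iff forall_2)
qed

section \<open>Ellipticity\<close>

text \<open>Injectivity excludes a range collapsed to a single vector, for which independence of the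
  range would say too little.\<close>

lemma independent_pair:
  fixes \<nu> :: "2 \<Rightarrow> 'a::real_vector"
  assumes "inj \<nu>" "independent (range \<nu>)" and "a *\<^sub>R \<nu> 1 + b *\<^sub>R \<nu> 2 = 0"
  shows "a = 0 \<and> b = 0"
proof -
  have ne: "\<nu> 1 \<noteq> \<nu> 2"
    using injD[OF assms(1), of 1 2] by auto
  let ?f = "\<lambda>v. if v = \<nu> 1 then a else b"
  have "range \<nu> = {\<nu> 1, \<nu> 2}"
    by (simp add: UNIV_2)
  moreover from this have "(\<Sum>v\<in>range \<nu>. ?f v *\<^sub>R v) = 0"
    using ne assms(3) by simp
  ultimately have "?f v = 0" if "v \<in> range \<nu>" for v
    using independentD[OF assms(2) _ order_refl _ that, of ?f] by simp
  from this[of "\<nu> 1"] this[of "\<nu> 2"] ne show ?thesis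
    by auto
qed

lemma (in metric_frame) frame_perp_eq_0D:
  "frame_perp G t V = 0 \<Longrightarrow> V = frame_coord G t 1 V *\<^sub>R t 1 + frame_coord G t 2 V *\<^sub>R t 2"
  by (simp add: frame_perp_def frame_proj_def sum_2)

text \<open>Tangent and normal frame together span the four-dimensional space. The error of the
  expansion is orthogonal to all four vectors, hence to itself.\<close>

lemma normal_expansion:
  fixes G :: "real ^ 4 ^ 4"
  assumes "metric_frame G t" and "metric_frame G \<nu>"
    and orth: "\<And>i a. bilin G (\<nu> i) (t a) = 0" and V: "\<And>a. bilin G V (t a) = 0"
  shows "(\<Sum>i\<in>UNIV. frame_coord G \<nu> i V *\<^sub>R \<nu> i) = V"
proof -
  interpret T: metric_frame G t by fact
  interpret N: metric_frame G \<nu> by fact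
  \<comment> \<open>Source and target both have dimension 4, so injectivity of \<open>?L\<close>
    yields that the four vectors span.\<close>
  let ?L = "\<lambda>c :: real ^ 4. (c $ 1 *\<^sub>R t 1 + c $ 2 *\<^sub>R t 2) + (c $ 3 *\<^sub>R \<nu> 1 + c $ 4 *\<^sub>R \<nu> 2)"
  have lin: "linear ?L"
    by (intro linearI) (simp_all add: algebra_simps)
  have "inj ?L"
    unfolding linear_injective_0[OF lin]
  proof (intro allI impI)
    fix c :: "real ^ 4"
    assume 0: "?L c = 0"
    let ?T = "c $ 1 *\<^sub>R t 1 + c $ 2 *\<^sub>R t 2"
    have "bilin G (?L c) ?T = bilin G ?T ?T"
      by (simp add: bilin_simps orth)
    then have "?T = 0"
      using T.metric_eq_0 unfolding 0 by simp
    with 0 have "c $ 3 *\<^sub>R \<nu> 1 + c $ 4 *\<^sub>R \<nu> 2 = 0"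
      by simp
    from T.frame_independent[OF \<open>?T = 0\<close>] N.frame_independent[OF this] show "c = 0"
      by (simp add: vec_eq_iff forall_4)
  qed
  then have "surj ?L"
    by (rule linear_injective_imp_surjective[OF lin _ refl])
  let ?E = "frame_perp G \<nu> V"
  obtain c where c: "?E = ?L c"
    using \<open>surj ?L\<close> by (rule surjE)
  have "bilin G (frame_proj G \<nu> V) (t a) = 0" for a
    by (simp add: frame_proj_def sum_2 bilin_simps orth)
  then have "bilin G ?E (t a) = 0" for a
    using V by (simp add: frame_perp_def bilin_simps)
  then have "bilin G ?E (?L c) = 0"
    by (simp add: bilin_simps N.metric_frame_perp)
  then have "?E = 0"
    using T.metric_eq_0 unfolding c[symmetric] by blast
  then show ?thesis
    by (simp add: frame_perp_def frame_proj_def)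
qed

lemma linear_jet2_expansion:
  fixes f :: "real ^ 2 ^ 2 ^ 2 \<Rightarrow> real"
  assumes "linear f"
  shows "f h = (\<Sum>j\<in>UNIV. \<Sum>a\<in>UNIV. \<Sum>b\<in>UNIV. f (axis a (axis b (axis j 1))) * h $ a $ b $ j)"
proof -
  have "h = (\<Sum>j\<in>UNIV. \<Sum>a\<in>UNIV. \<Sum>b\<in>UNIV. h $ a $ b $ j *\<^sub>R axis a (axis b (axis j 1)))"
    by (simp add: vec_eq_iff forall_2 sum_2 axis_def)
  then have "f h = f (\<Sum>j\<in>UNIV. \<Sum>a\<in>UNIV. \<Sum>b\<in>UNIV. h $ a $ b $ j *\<^sub>R axis a (axis b (axis j 1)))"
    by (rule arg_cong)
  then show ?thesis
    by (simp add: linear_sum[OF assms] linear_scale[OF assms] mult.commute)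
qed

text \<open>Reduces ellipticity to linear algebra at each jet: the coefficients are the
  \<open>\<nu>\<close>-components of the maps \<open>X q\<close> and of the remainder
  \<open>Y q\<close>, and an invertible symbol means that \<open>X q\<close> kills no nonzero
  \<open>w\<close> inserted along a nonzero \<xi>.\<close>

lemma elliptic_quasilinearI:
  fixes X :: "jet1 \<Rightarrow> real ^ 2 ^ 2 ^ 2 \<Rightarrow> real ^ 4" and Y :: "jet1 \<Rightarrow> real ^ 4"
    and G :: "jet1 \<Rightarrow> real ^ 4 ^ 4" and t :: "jet1 \<Rightarrow> 2 \<Rightarrow> real ^ 4"
  assumes lin: "\<And>q. linear (X q)"
    and frames: "\<And>W u z. (W, u) \<in> \<U> \<Longrightarrow> z \<in> W \<Longrightarrow>
      metric_frame (G (jet1_of u z)) (t (jet1_of u z)) \<and>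
      metric_frame (G (jet1_of u z)) (\<nu> (jet1_of u z)) \<and>
      (\<forall>i a. bilin (G (jet1_of u z)) (\<nu> (jet1_of u z) i) (t (jet1_of u z) a) = 0)"
    and normal: "\<And>W u z h a. (W, u) \<in> \<U> \<Longrightarrow> z \<in> W \<Longrightarrow>
      bilin (G (jet1_of u z)) (X (jet1_of u z) h) (t (jet1_of u z) a) = 0 \<and>
      bilin (G (jet1_of u z)) (Y (jet1_of u z)) (t (jet1_of u z) a) = 0"
    and L: "\<And>W u z. (W, u) \<in> \<U> \<Longrightarrow> z \<in> W \<Longrightarrow>
      L u z = X (jet1_of u z) (\<chi> a b. dirderiv (axis a 1) (dirderiv (axis b 1) u) z) + Y (jet1_of u z)"
    and symbol: "\<And>W u z \<xi> w. (W, u) \<in> \<U> \<Longrightarrow> z \<in> W \<Longrightarrow> \<xi> \<noteq> 0 \<Longrightarrow> w \<noteq> 0 \<Longrightarrow>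
      X (jet1_of u z) (\<chi> a b. (\<xi> $ a * \<xi> $ b) *\<^sub>R w) \<noteq> 0"
  shows "elliptic_quasilinear \<U> L \<nu>"
proof -
  define A where "A = (\<lambda>q i j a b. frame_coord (G q) (\<nu> q) i (X q (axis a (axis b (axis j 1)))))"
  define B where "B = (\<lambda>q i. frame_coord (G q) (\<nu> q) i (Y q))"
  have A: "(\<Sum>j\<in>UNIV. \<Sum>a\<in>UNIV. \<Sum>b\<in>UNIV. A q i j a b * h $ a $ b $ j)
      = frame_coord (G q) (\<nu> q) i (X q h)" for q i h
    unfolding A_def
    by (rule linear_jet2_expansion[symmetric])
       (use linear_compose[OF lin linear_frame_coord] in \<open>simp add: o_def\<close>)
  have eq: "L u z = (\<Sum>i\<in>UNIV. ((\<Sum>j\<in>UNIV. \<Sum>a\<in>UNIV. \<Sum>b\<in>UNIV.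
        A q i j a b * dirderiv (axis a 1) (dirderiv (axis b 1) u) z $ j) + B q i) *\<^sub>R \<nu> q i)"
    if "(W, u) \<in> \<U>" "z \<in> W" and q: "q = jet1_of u z" for W u z q
  proof -
    let ?h = "\<chi> a b. dirderiv (axis a 1) (dirderiv (axis b 1) u) z"
    have "L u z = (\<Sum>i\<in>UNIV. frame_coord (G q) (\<nu> q) i (X q ?h + Y q) *\<^sub>R \<nu> q i)"
      using L[OF that(1,2)] normal[OF that(1,2)] frames[OF that(1,2)] unfolding q
      by (subst normal_expansion) (auto simp: bilin_simps)
    then show ?thesis
      using A[of q _ ?h] by (simp add: frame_coord_add B_def)
  qed
  have det: "det (principal_symbol (A q) \<xi>) \<noteq> 0"
    if "(W, u) \<in> \<U>" "z \<in> W" "\<xi> \<noteq> 0" and q: "q = jet1_of u z" for W u z q and \<xi> :: "real ^ 2"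
  proof
    assume "det (principal_symbol (A q) \<xi>) = 0"
    \<comment> \<open>A vanishing determinant provides a kernel vector \<open>w\<close> of the
      symbol, to be used as the variation.\<close>
    then have "\<not> (\<exists>B. B ** principal_symbol (A q) \<xi> = mat 1)"
      using invertible_det_nz invertible_left_inverse by blast
    then obtain w where w: "w \<noteq> 0" "principal_symbol (A q) \<xi> *v w = 0"
      unfolding matrix_left_invertible_ker by blast
    let ?h = "\<chi> a b. (\<xi> $ a * \<xi> $ b) *\<^sub>R w"
    \<comment> \<open>Contracting the coefficients with \<xi>, \<xi> and \<open>w\<close> is the
      same as applying the symbol matrix to \<open>w\<close>.\<close>
    have "frame_coord (G q) (\<nu> q) i (X q ?h) = (principal_symbol (A q) \<xi> *v w) $ i" for i
      unfolding A[symmetric]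
      by (simp add: principal_symbol_def matrix_vector_mult_def sum_distrib_right mult.assoc)
    then have "(\<Sum>i\<in>UNIV. frame_coord (G q) (\<nu> q) i (X q ?h) *\<^sub>R \<nu> q i) = 0"
      using w(2) by simp
    moreover have "(\<Sum>i\<in>UNIV. frame_coord (G q) (\<nu> q) i (X q ?h) *\<^sub>R \<nu> q i) = X q ?h"
      using normal[OF that(1,2)] frames[OF that(1,2)] unfolding q by (intro normal_expansion) auto
    ultimately show False
      using symbol[OF that(1-3) w(1)] q by simp
  qed
  show ?thesis
    unfolding elliptic_quasilinear_def Let_def
    by (rule exI[of _ A], rule exI[of _ B]) (use eq det in blast)
qed

section \<open>From Kaehler data on the manifold to pointwise data\<close>

lemma kaehler_metric_sym:
  assumes "\<And>U V. bilin \<omega> (J *v U) (J *v V) = bilin \<omega> U V"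
    and "\<And>U V. bilin \<omega> U V = - bilin \<omega> V U" and "\<And>U. J *v (J *v U) = - U"
  shows "bilin (kaehler_metric \<omega> J) U V = bilin (kaehler_metric \<omega> J) V U"
proof -
  have *: "bilin (kaehler_metric \<omega> J) U V = bilin \<omega> U (J *v V)" for U V
    by (simp add: bilin_def kaehler_metric_def matrix_vector_mul_assoc)
  have "bilin \<omega> U (J *v V) = bilin \<omega> (J *v U) (J *v (J *v V))"
    by (simp add: assms(1))
  also have "\<dots> = bilin \<omega> V (J *v U)"
    using assms(2)[of V] by (simp add: assms(3) bilin_simps)
  finally show ?thesis
    by (simp add: *)
qed

lemma bilin_skew:
  assumes "transpose A = - A"
  shows "bilin A U V = - bilin A V U"
proof -
  have "bilin A U V = (transpose A *v U) \<bullet> V"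
    by (simp add: bilin_def dot_lmul_matrix transpose_matrix_vector)
  \<comment> \<open>The instance at 0 supplies \<open>(- A) *v U = - (A *v U)\<close>.\<close>
  also have "\<dots> = - bilin A V U"
    using assms matrix_vector_mult_diff_rdistrib[of 0 A U] by (simp add: bilin_def inner_commute)
  finally show ?thesis .
qed

lemma kaehler_surface_hermitian_frame:
  assumes M: "kaehler_surface M \<A> \<omega> J" and c: "c \<in> \<A>" and x: "x \<in> chart_image c"
    and s: "s \<in> {1, -1}"
    and t: "\<And>a b. a *\<^sub>R t 1 + b *\<^sub>R t 2 = 0 \<Longrightarrow> a = 0 \<and> b = 0"
    and pos: "frame_cos (\<omega> c x) (kaehler_metric (\<omega> c x) (J c x)) s t > 0"
  shows "hermitian_frame (\<omega> c x) (J c x) t s"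
proof -
  have J: "J c x *v (J c x *v U) = - U" for U
    using M c x complex_structure_square unfolding kaehler_surface_def by blast
  have skew: "bilin (\<omega> c x) U V = - bilin (\<omega> c x) V U" for U V
    using M c x bilin_skew unfolding kaehler_surface_def closed_2form_def by blast
  have inv: "bilin (\<omega> c x) (J c x *v U) (J c x *v V) = bilin (\<omega> c x) U V" for U V
    using M c x unfolding kaehler_surface_def by blast
  show ?thesis
  proof
    show "bilin (kaehler_metric (\<omega> c x) (J c x)) U U > 0" if "U \<noteq> 0" for U
      using that M c x unfolding kaehler_surface_def by blast
  qed (fact J skew s t pos kaehler_metric_sym[OF inv skew J])+
qed

lemma kaehler_surface_differentiable:
  assumes M: "kaehler_surface M \<A> \<omega> J" and c: "c \<in> \<A>" and x: "x \<in> chart_image c"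
  shows "\<omega> c differentiable (at x)" and "metric_field (\<omega> c) (J c) differentiable (at x)"
proof -
  have "smooth_on (chart_image c) (\<omega> c)"
    using M c unfolding kaehler_surface_def closed_2form_def covariant_tensor_def by blast
  moreover have "smooth_on (chart_image c) (J c)"
    using M c unfolding kaehler_surface_def complex_structure_def endomorphism_tensor_def by blast
  ultimately have *: "\<omega> c differentiable (at x)" "J c differentiable (at x)"
    using x by (blast intro: smooth_on_differentiable)+
  then show "\<omega> c differentiable (at x)" "metric_field (\<omega> c) (J c) differentiable (at x)"
    unfolding metric_field_def kaehler_metric_def differentiable_def
    using bounded_bilinear.FDERIV[OF bounded_bilinear_matrix_mult] by blast+
qed

theorem theorem2p3:
  fixes M :: "'a topology"
    and \<A> :: "('a, 4) chart set"
    and \<omega> J :: "('a, 4) tensor2"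
    and c :: "('a, 4) chart"
    and s :: real
    and \<nu> :: "jet1 \<Rightarrow> 2 \<Rightarrow> real ^ 4"
  assumes "kaehler_surface M \<A> \<omega> J"
    and "c \<in> \<A>"
    and "s \<in> {1, -1}"
    and "normal_frame (metric_field (\<omega> c) (J c))
           (symplectic_graphs (chart_image c) (\<omega> c) (J c) s) \<nu>"
  shows "elliptic_quasilinear
           (symplectic_graphs (chart_image c) (\<omega> c) (J c) s)
           (\<lambda>u. surface_operator (\<omega> c) (J c) s (graph u)) \<nu>"
proof -
  let ?\<U> = "symplectic_graphs (chart_image c) (\<omega> c) (J c) s"
  define w where "w = (\<lambda>q. \<omega> c (jet_point q))"
  define I where "I = (\<lambda>q. J c (jet_point q))"
  define G where "G = (\<lambda>q. kaehler_metric (w q) (I q))"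
  \<comment> \<open>\<open>h\<close> is the array of second derivatives of \<open>u\<close>; it
    enters through vertical vectors.\<close>
  define X where "X = (\<lambda>q (h :: real ^ 2 ^ 2 ^ 2).
    frame_principal (w q) (I q) s (jet_tang q) (\<lambda>a b. graph_vec 0 (h $ a $ b)))"
  define Y where "Y = (\<lambda>q. frame_operator (w q) (I q) s (jet_tang q)
    (\<lambda>a b. christoffel (metric_field (\<omega> c) (J c)) (jet_point q) (jet_tang q a) (jet_tang q b))
    (\<lambda>b. frame_cos_deriv (w q) (G q) s (jet_tang q)
      (dirderiv (jet_tang q b) (\<omega> c) (jet_point q))
      (dirderiv (jet_tang q b) (metric_field (\<omega> c) (J c)) (jet_point q)) (\<lambda>_. 0)))"
  have in_\<U>: "open W" "smooth_on W u" "graph u z \<in> chart_image c" "u differentiable (at z)"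
      "cos_kaehler_angle (\<omega> c) (J c) s (graph u) z > 0"
    if "(W, u) \<in> ?\<U>" "z \<in> W" for W u z
    using that smooth_on_differentiable by (auto simp: symplectic_graphs_def)
  have herm: "hermitian_frame (w (jet1_of u z)) (I (jet1_of u z)) (jet_tang (jet1_of u z)) s"
    if "(W, u) \<in> ?\<U>" "z \<in> W" for W u z
    unfolding w_def I_def jet_point_jet1_of
    using in_\<U>[OF that]
    by (intro kaehler_surface_hermitian_frame[OF assms(1,2) _ assms(3)
        jet_tang_independent[where q = "jet1_of u z"]])
      (auto simp: cos_kaehler_angle_eq jet_tang_jet1_of metric_field_def)
  have frame: "metric_frame (G (jet1_of u z)) (jet_tang (jet1_of u z))"
    if "(W, u) \<in> ?\<U>" "z \<in> W" for W u z
    using herm[OF that] by (simp add: hermitian_frame_def G_def)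
  show ?thesis
  proof (rule elliptic_quasilinearI[where G = G and t = jet_tang and X = X and Y = Y])
    have "graph_vec 0 (y + y') = graph_vec 0 y + graph_vec 0 y'" for y y'
      using graph_vec_add[of 0 0] by simp
    moreover have "graph_vec 0 (r *\<^sub>R y) = r *\<^sub>R graph_vec 0 y" for r y
      using graph_vec_scaleR[of r 0] by simp
    ultimately show "linear (X q)" for q
      by (intro linearI) (simp_all add: X_def frame_principal_add frame_principal_scaleR)
  next
    fix W u z
    assume Wu: "(W, u) \<in> ?\<U>" "z \<in> W"
    let ?q = "jet1_of u z"
    interpret hermitian_frame "w ?q" "I ?q" "jet_tang ?q" s
      by (rule herm[OF Wu])
    have G_eq: "G ?q = metric_field (\<omega> c) (J c) (graph u z)"
      by (simp add: G_def w_def I_def metric_field_def jet_point_jet1_of)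
    have \<nu>: "inj (\<nu> ?q)" "independent (range (\<nu> ?q))"
        "\<And>i a. bilin (G ?q) (\<nu> ?q i) (jet_tang ?q a) = 0"
      using assms(4) Wu unfolding normal_frame_def G_eq jet_tang_jet1_of[OF in_\<U>(4)[OF Wu]] by auto
    show "metric_frame (G ?q) (jet_tang ?q) \<and> metric_frame (G ?q) (\<nu> ?q) \<and>
        (\<forall>i a. bilin (G ?q) (\<nu> ?q i) (jet_tang ?q a) = 0)"
      using frame[OF Wu] \<nu> independent_pair[OF \<nu>(1,2)] unfolding metric_frame_def by blast
    show "bilin (G ?q) (X ?q h) (jet_tang ?q a) = 0 \<and> bilin (G ?q) (Y ?q) (jet_tang ?q a) = 0" for h a
      unfolding X_def Y_def frame_principal_def G_def by (simp add: metric_frame_operator)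
    note tang = has_derivative_tang_graph[OF in_\<U>(1,2)[OF Wu] Wu(2)]
    \<comment> \<open>A nondegenerate area element is what permits differentiating the
      cosine.\<close>
    have "det (gram (metric_field (\<omega> c) (J c) (graph u z)) (\<lambda>a. tang (graph u) a z)) > 0"
      using metric_frame.det_gram_pos[OF frame[OF Wu]]
      by (simp add: G_eq jet_tang_jet1_of[OF in_\<U>(4)[OF Wu]])
    from surface_operator_eq[OF _ _ kaehler_surface_differentiable[OF assms(1,2) in_\<U>(3)[OF Wu]] this]
    show "surface_operator (\<omega> c) (J c) s (graph u) z
        = X ?q (\<chi> a b. dirderiv (axis a 1) (dirderiv (axis b 1) u) z) + Y ?q"
      using tang has_derivative_graph[OF in_\<U>(4)[OF Wu]]
      unfolding X_def Y_def w_def I_def G_eq jet_point_jet1_of jet_tang_jet1_of[OF in_\<U>(4)[OF Wu]]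
      by (auto simp: differentiable_def dirderiv_eq[OF tang])
    show "X ?q (\<chi> a b. (\<xi> $ a * \<xi> $ b) *\<^sub>R y) \<noteq> 0" if "\<xi> \<noteq> 0" "y \<noteq> 0" for \<xi> y :: "real ^ 2"
    proof -
      obtain b where "\<xi> $ b \<noteq> 0"
        using \<open>\<xi> \<noteq> 0\<close> by (auto simp: vec_eq_iff)
      \<comment> \<open>A vertical vector with zero normal part would be tangent to the graph,
        against transversality.\<close>
      moreover have "frame_perp (kaehler_metric (w ?q) (I ?q)) (jet_tang ?q) (graph_vec 0 y) \<noteq> 0"
        using frame_perp_eq_0D graph_vec_0_eq_jet_tang \<open>y \<noteq> 0\<close> by blast
      ultimately show ?thesis
        using frame_principal_nonzero[of "\<lambda>a. \<xi> $ a"] graph_vec_scaleR[of _ 0 y] by (simp add: X_def)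
    qed
  qed
qed

end
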